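(* If $r,s,t\ge 0$ are real numbers, then $(r^2x^2+s^2y^2+t^2z^2)R(x,y,z)$ is sos if and only if $r\le s+t$, $s\le r+t$ and $t\le r+s$.
   Context: A form is sos if it is a finite sum of squares of real forms. Here $$R(x,y,z)=x^6+y^6+z^6-x^4y^2-x^2y^4-x^4z^2-y^4z^2-x^2z^4-y^2z^4+3x^2y^2z^2.$$ *)

theory Defs
  imports Complex_Main "HOL-Library.Poly_Mapping"
begin

datatype var = Vx | Vy | Vz

text \<open>
  Formal polynomials in three variables: a monomial is its finitely supported exponent
  function, and a polynomial is a finitely supported function from monomials to
  coefficients. Multiplication is the convolution product of \<^theory>\<open>HOL-Library.Poly_Mapping\<close>.
\<close>

type_synonym tpoly = "(var \<Rightarrow>\<^sub>0 nat) \<Rightarrow>\<^sub>0 real"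

definition Const :: "real \<Rightarrow> tpoly" where
  "Const c = Poly_Mapping.single 0 c"

definition Var :: "var \<Rightarrow> tpoly" where
  "Var v = Poly_Mapping.single (Poly_Mapping.single v 1) 1"

abbreviation X :: tpoly where "X \<equiv> Var Vx"
abbreviation Y :: tpoly where "Y \<equiv> Var Vy"
abbreviation Z :: tpoly where "Z \<equiv> Var Vz"

definition mon_degree :: "(var \<Rightarrow>\<^sub>0 nat) \<Rightarrow> nat" where
  "mon_degree m = (\<Sum>v\<in>{Vx, Vy, Vz}. Poly_Mapping.lookup m v)"

text \<open>The zero polynomial is a form, of every degree.\<close>

definition is_form :: "tpoly \<Rightarrow> bool" where
  "is_form p \<longleftrightarrow> (\<exists>d. \<forall>m\<in>Poly_Mapping.keys p. mon_degree m = d)"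

definition is_sos :: "tpoly \<Rightarrow> bool" where
  "is_sos p \<longleftrightarrow> is_form p \<and>
     (\<exists>(n::nat) (h :: nat \<Rightarrow> tpoly). (\<forall>i<n. is_form (h i)) \<and> p = (\<Sum>i<n. (h i)^2))"

definition R :: tpoly where
  "R = X^6 + Y^6 + Z^6 - X^4 * Y^2 - X^2 * Y^4 - X^4 * Z^2 - Y^4 * Z^2
       - X^2 * Z^4 - Y^2 * Z^4 + 3 * X^2 * Y^2 * Z^2"

end

theory Submission
  imports Defs "HOL-Analysis.L2_Norm"
begin

text \<open>
  Every quartic form \<open>h\<close> satisfies
  \<open>h(1,0,0) + h(0,1,0) + h(0,0,1) = A / 2 - B / 4\<close>, where \<open>A\<close> is the sum of \<open>h\<close> over the six
  points of type \<open>(1,\<plusminus>1,0)\<close> and \<open>B\<close> the sum over the four points \<open>(1,\<plusminus>1,\<plusminus>1)\<close>. These ten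
  points are zeros of \<open>R\<close>. If the product is a sum of squares of forms \<open>h\<^sub>i\<close>, then the nonzero
  \<open>h\<^sub>i\<close> are quartics which vanish there, so the vectors \<open>(h\<^sub>i(1,0,0))\<^sub>i\<close>, \<open>(h\<^sub>i(0,1,0))\<^sub>i\<close>,
  \<open>(h\<^sub>i(0,0,1))\<^sub>i\<close> add up to zero. Their Euclidean norms are \<open>r\<close>, \<open>s\<close>, \<open>t\<close>, which gives the
  triangle inequalities.

  Conversely, put \<open>f = (z\<^sup>2 - x\<^sup>2)(z\<^sup>2 + x\<^sup>2 - y\<^sup>2)\<close> and \<open>g = (x\<^sup>2 - y\<^sup>2)(x\<^sup>2 + y\<^sup>2 - z\<^sup>2)\<close>. The product
  equals the binary quadratic form \<open>t\<^sup>2 f\<^sup>2 + (s\<^sup>2 + t\<^sup>2 - r\<^sup>2) f g + s\<^sup>2 g\<^sup>2\<close> plus the squares of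
  \<open>r y z (y\<^sup>2 - z\<^sup>2)\<close>, \<open>s x z (z\<^sup>2 - x\<^sup>2)\<close> and \<open>t x y (x\<^sup>2 - y\<^sup>2)\<close>, and the triangle inequalities
  say that the binary form is positive semidefinite.
\<close>

section \<open>Evaluation of polynomials\<close>

definition mon_value :: "(var \<Rightarrow> real) \<Rightarrow> (var \<Rightarrow>\<^sub>0 nat) \<Rightarrow> real" where
  "mon_value a m = (\<Prod>v\<in>{Vx, Vy, Vz}. a v ^ Poly_Mapping.lookup m v)"

definition value_at :: "(var \<Rightarrow> real) \<Rightarrow> tpoly \<Rightarrow> real" where
  "value_at a p = (\<Sum>m\<in>Poly_Mapping.keys p. Poly_Mapping.lookup p m * mon_value a m)"

lemma mon_value_add: "mon_value a (m + n) = mon_value a m * mon_value a n"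
  by (simp add: mon_value_def lookup_add power_add)

lemma mon_value_zero [simp]: "mon_value a 0 = 1"
  by (simp add: mon_value_def)

lemma value_at_zero [simp]: "value_at a 0 = 0"
  by (simp add: value_at_def)

lemma value_at_single [simp]: "value_at a (Poly_Mapping.single m c) = c * mon_value a m"
  by (simp add: value_at_def)

lemma value_at_add [simp]: "value_at a (p + q) = value_at a p + value_at a q"
  unfolding value_at_def
  by (rule setsum_keys_plus_distrib[where f = "\<lambda>m c. c * mon_value a m"])
    (simp_all add: algebra_simps)

lemma value_at_sum [simp]: "value_at a (\<Sum>i\<in>I. f i) = (\<Sum>i\<in>I. value_at a (f i))"
  by (induction I rule: infinite_finite_induct) simp_all

text \<open>Writes a polynomial as a sum of monomials, so that multiplicativity of evaluation
  reduces to products of \<open>single\<close> terms.\<close>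

lemma sum_single_lookup:
  fixes p :: "'a \<Rightarrow>\<^sub>0 'b::comm_monoid_add"
  shows "(\<Sum>m\<in>Poly_Mapping.keys p. Poly_Mapping.single m (Poly_Mapping.lookup p m)) = p"
proof (rule poly_mapping_eqI)
  fix k
  show "Poly_Mapping.lookup
      (\<Sum>m\<in>Poly_Mapping.keys p. Poly_Mapping.single m (Poly_Mapping.lookup p m)) k
    = Poly_Mapping.lookup p k"
    by (simp add: lookup_sum lookup_single when_def sum.delta' in_keys_iff)
qed

lemma value_at_mult [simp]: "value_at a (p * q) = value_at a p * value_at a q"
proof -
  have "value_at a (p * q) = value_at a
      ((\<Sum>m\<in>Poly_Mapping.keys p. Poly_Mapping.single m (Poly_Mapping.lookup p m)) *
       (\<Sum>n\<in>Poly_Mapping.keys q. Poly_Mapping.single n (Poly_Mapping.lookup q n)))"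
    by (simp add: sum_single_lookup)
  also have "\<dots> = value_at a p * value_at a q"
    unfolding value_at_def[of a p] value_at_def[of a q]
    by (simp add: sum_product mult_single mon_value_add mult_ac)
  finally show ?thesis .
qed

lemma value_at_one [simp]: "value_at a 1 = 1"
  unfolding single_one[symmetric] by (simp del: single_one)

lemma value_at_power [simp]: "value_at a (p ^ n) = value_at a p ^ n"
  by (induction n) simp_all

lemma value_at_diff [simp]: "value_at a (p - q) = value_at a p - value_at a q"
  using value_at_add[of a "p - q" q] by (simp del: value_at_add)

lemma value_at_numeral [simp]: "value_at a (numeral n) = numeral n"
  by (induction n) (simp_all only: numeral.simps value_at_add value_at_one)

lemma value_at_Const [simp]: "value_at a (Const c) = c"
  by (simp add: Const_def)

lemma value_at_Var [simp]: "value_at a (Var v) = a v"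
  by (cases v) (simp_all add: Var_def mon_value_def lookup_single when_def)

fun pt :: "real \<Rightarrow> real \<Rightarrow> real \<Rightarrow> var \<Rightarrow> real" where
  "pt x y z Vx = x"
| "pt x y z Vy = y"
| "pt x y z Vz = z"

lemma mon_value_pt:
  "mon_value (pt x y z) m =
     x ^ Poly_Mapping.lookup m Vx * y ^ Poly_Mapping.lookup m Vy * z ^ Poly_Mapping.lookup m Vz"
  by (simp add: mon_value_def)

section \<open>Homogeneous polynomials\<close>

text \<open>Unlike \<open>is_form\<close>, the degree is explicit, which makes the notion closed
  under addition.\<close>

definition homog :: "nat \<Rightarrow> tpoly \<Rightarrow> bool" where
  "homog d p \<longleftrightarrow> (\<forall>m\<in>Poly_Mapping.keys p. mon_degree m = d)"

lemma is_form_iff_homog: "is_form p \<longleftrightarrow> (\<exists>d. homog d p)"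
  by (simp add: is_form_def homog_def)

lemma homog_add: "homog d p \<Longrightarrow> homog d q \<Longrightarrow> homog d (p + q)"
  unfolding homog_def using keys_add[of p q] by blast

lemma homog_uminus: "homog d p \<Longrightarrow> homog d (- p)"
  by (simp add: homog_def)

lemma homog_diff: "homog d p \<Longrightarrow> homog d q \<Longrightarrow> homog d (p - q)"
  using homog_add[of d p "- q"] homog_uminus[of d q] by simp

lemma mon_degree_add: "mon_degree (m + n) = mon_degree m + mon_degree n"
  by (simp add: mon_degree_def lookup_add)

lemma homog_mult: "homog d p \<Longrightarrow> homog e q \<Longrightarrow> homog (d + e) (p * q)"
  unfolding homog_def using keys_mult[of p q] by (fastforce simp: mon_degree_add)

lemma homog_Const: "homog 0 (Const c)"
  by (simp add: homog_def Const_def mon_degree_def)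

lemma homog_Var: "homog 1 (Var v)"
  by (cases v) (simp_all add: homog_def Var_def mon_degree_def lookup_single when_def)

lemma homog_power: "homog d p \<Longrightarrow> homog (d * n) (p ^ n)"
proof (induction n)
  case 0
  then show ?case using homog_Const[of 1] by (simp add: Const_def)
next
  case (Suc n)
  then show ?case using homog_mult[of d p "d * n" "p ^ n"] by simp
qed

lemma homog_Var_power: "homog n (Var v ^ n)"
  using homog_power[OF homog_Var, of n v] by simp

lemma homog_Const_mult: "homog d p \<Longrightarrow> homog d (Const c * p)"
  using homog_mult[OF homog_Const] by fastforce

lemma value_at_homog_scale:
  assumes "homog d p"
  shows "value_at (\<lambda>v. c * a v) p = c ^ d * value_at a p"
proof -
  have "mon_value (\<lambda>v. c * a v) m = c ^ d * mon_value a m" if "m \<in> Poly_Mapping.keys p" for m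
  proof -
    have "mon_degree m = d"
      using assms that by (simp add: homog_def)
    then show ?thesis
      by (auto simp: mon_value_def mon_degree_def power_mult_distrib power_add)
  qed
  then show ?thesis
    by (simp add: value_at_def sum_distrib_left mult_ac)
qed

text \<open>If \<open>d < e\<close> the inequality fails for small \<open>l\<close>, if
  \<open>e < d\<close> for large \<open>l\<close>. This will fix the degree of each summand in a sum
  of squares.\<close>

lemma degree_eq_if_scaling_le:
  fixes c F :: real
  assumes "c > 0" and le: "\<And>l. l > 0 \<Longrightarrow> l ^ (2 * d) * c \<le> l ^ (2 * e) * F"
  shows "d = e"
proof -
  have cF: "c \<le> F"
    using le[of 1] by simp
  show ?thesis
  proof (rule linorder_cases[of d e])
    assume "d < e"
    \<comment> \<open>Chosen so that \<open>l * F = c / 2 < c\<close>.\<close>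
    define l where "l = c / (2 * F)"
    have l: "l > 0" "l \<le> 1"
      using assms(1) cF by (auto simp: l_def)
    have "l ^ (2 * e) = l ^ (2 * d) * l ^ (2 * e - 2 * d)"
      using \<open>d < e\<close> by (simp flip: power_add)
    then have "c \<le> l ^ (2 * e - 2 * d) * F"
      using le[OF l(1)] l(1) by (simp add: mult.assoc)
    also have "\<dots> \<le> l ^ 1 * F"
      using \<open>d < e\<close> l assms(1) cF by (intro mult_right_mono power_decreasing) auto
    also have "\<dots> = c / 2"
      using assms(1) cF by (simp add: l_def)
    finally show ?thesis
      using assms(1) by simp
  next
    assume "e < d"
    \<comment> \<open>Chosen so that \<open>l * c = c + F > F\<close>.\<close>
    define l where "l = 1 + F / c"
    have l: "l \<ge> 1"
      using assms(1) cF by (auto simp: l_def)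
    have "l ^ (2 * d) = l ^ (2 * e) * l ^ (2 * d - 2 * e)"
      using \<open>e < d\<close> by (simp flip: power_add)
    then have "l ^ (2 * d - 2 * e) * c \<le> F"
      using le[of l] l by (simp add: mult.assoc)
    moreover have "l ^ 1 * c \<le> l ^ (2 * d - 2 * e) * c"
      using \<open>e < d\<close> l assms(1) by (intro mult_right_mono power_increasing) auto
    moreover have "l * c = c + F"
      using assms(1) by (simp add: l_def field_simps)
    ultimately show ?thesis
      using assms(1) by simp
  qed
qed

section \<open>Necessity\<close>

text \<open>By linearity only monomials matter. An odd exponent makes both sides 0; a fourth power
  gives 4/2 - 4/4 = 1, and a product of two squares gives 2/2 - 4/4 = 0.\<close>

lemma quartic_relation:
  assumes "homog 4 p"
  shows "value_at (pt 1 0 0) p + value_at (pt 0 1 0) p + value_at (pt 0 0 1) p =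
    (value_at (pt 1 1 0) p + value_at (pt 1 (-1) 0) p + value_at (pt 1 0 1) p
      + value_at (pt 1 0 (-1)) p + value_at (pt 0 1 1) p + value_at (pt 0 1 (-1)) p) / 2
    - (value_at (pt 1 1 1) p + value_at (pt 1 1 (-1)) p + value_at (pt 1 (-1) 1) p
      + value_at (pt 1 (-1) (-1)) p) / 4"
proof -
  have mon: "mon_value (pt 1 0 0) m + mon_value (pt 0 1 0) m + mon_value (pt 0 0 1) m =
    (mon_value (pt 1 1 0) m + mon_value (pt 1 (-1) 0) m + mon_value (pt 1 0 1) m
      + mon_value (pt 1 0 (-1)) m + mon_value (pt 0 1 1) m + mon_value (pt 0 1 (-1)) m) / 2
    - (mon_value (pt 1 1 1) m + mon_value (pt 1 1 (-1)) m + mon_value (pt 1 (-1) 1) m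
      + mon_value (pt 1 (-1) (-1)) m) / 4"
    if "m \<in> Poly_Mapping.keys p" for m
  proof -
    obtain i j k where ijk: "i = Poly_Mapping.lookup m Vx" "j = Poly_Mapping.lookup m Vy"
      "k = Poly_Mapping.lookup m Vz"
      by blast
    then have deg: "i + j + k = 4"
      using assms that by (simp add: homog_def mon_degree_def add.assoc)
    then have "i \<in> {0, 1, 2, 3, 4}" "j \<in> {0, 1, 2, 3, 4}" "k = 4 - i - j" "i + j \<le> 4"
      by auto
    then show ?thesis
      unfolding mon_value_pt ijk[symmetric] by auto
  qed
  show ?thesis
    unfolding value_at_def sum.distrib[symmetric] sum_subtractf[symmetric] sum_divide_distrib
    using mon
    by (intro sum.cong refl) (simp add: right_diff_distrib flip: distrib_left)
qed

definition weighted_R :: "real \<Rightarrow> real \<Rightarrow> real \<Rightarrow> tpoly" where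
  "weighted_R r s t = (Const (r^2) * X^2 + Const (s^2) * Y^2 + Const (t^2) * Z^2) * R"

lemma homog_weighted_R: "homog 8 (weighted_R r s t)"
proof -
  have mono: "homog (i + j) (Var u ^ i * Var v ^ j)" for i j u v
    by (intro homog_mult homog_Var_power)
  have c: "(3 :: tpoly) = Const 3"
    by (simp add: Const_def)
  have "homog (2 + 2 + 2) (Const 3 * X^2 * Y^2 * Z^2)"
    by (intro homog_mult homog_Var_power homog_Const_mult)
  then have "homog 6 R"
    unfolding R_def c using mono[of 4 2] mono[of 2 4]
    by (intro homog_add homog_diff homog_Var_power) simp_all
  then have "homog (2 + 6) (weighted_R r s t)"
    unfolding weighted_R_def
    by (intro homog_mult homog_add homog_Const_mult homog_Var_power)
  then show ?thesis
    by simp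
qed

lemma sos_weighted_R_imp_zero_sums:
  fixes n :: nat
  assumes hom: "\<And>i. i < n \<Longrightarrow> is_form (h i)"
    and eq: "weighted_R r s t = (\<Sum>i<n. (h i)\<^sup>2)"
    and i: "i < n"
  shows "value_at (pt 1 0 0) (h i) + value_at (pt 0 1 0) (h i) + value_at (pt 0 0 1) (h i) = 0"
\<comment> \<open>The zero polynomial is homogeneous of every degree, so the degree comparison needs
  a point where \<open>h i\<close> does not vanish.\<close>
proof (cases "\<forall>a. value_at a (h i) = 0")
  case True
  then show ?thesis
    by simp
next
  case False
  then obtain a where a: "value_at a (h i) \<noteq> 0"
    by blast
  obtain d where d: "homog d (h i)"
    using hom[OF i] by (auto simp: is_form_iff_homog)
  have le: "(value_at b (h i))\<^sup>2 \<le> value_at b (weighted_R r s t)" for b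
    using i member_le_sum[of i "{..<n}" "\<lambda>i. (value_at b (h i))\<^sup>2"] by (simp add: eq)
  \<comment> \<open>Each square is bounded by the whole sum; evaluate along the line through
    \<open>a\<close>.\<close>
  have "l ^ (2 * d) * (value_at a (h i))\<^sup>2 \<le> l ^ (2 * 4) * value_at a (weighted_R r s t)" for l
    using le[of "\<lambda>v. l * a v"]
    by (simp add: value_at_homog_scale[OF d] value_at_homog_scale[OF homog_weighted_R]
        power_mult_distrib flip: power_mult) (simp add: mult.commute)
  then have "d = 4"
    using a by (intro degree_eq_if_scaling_le[of "(value_at a (h i))\<^sup>2"]) simp_all
  have zero: "value_at b (h i) = 0" if "value_at b R = 0" for b
    using le[of b] that by (simp add: weighted_R_def)
  show ?thesis
    using d \<open>d = 4\<close> by (simp add: quartic_relation zero R_def)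
qed

lemma sos_weighted_R_imp_triangle:
  assumes "r \<ge> 0" "s \<ge> 0" "t \<ge> 0" and sos: "is_sos (weighted_R r s t)"
  shows "r \<le> s + t \<and> s \<le> r + t \<and> t \<le> r + s"
proof -
  obtain n :: nat and h where form: "\<And>i. i < n \<Longrightarrow> is_form (h i)"
    and eq: "weighted_R r s t = (\<Sum>i<n. (h i)\<^sup>2)"
    using sos unfolding is_sos_def by blast
  define A where "A i = value_at (pt 1 0 0) (h i)" for i
  define B where "B i = value_at (pt 0 1 0) (h i)" for i
  define C where "C i = value_at (pt 0 0 1) (h i)" for i
  define N where "N f = L2_set f {..<n}" for f
  have norm: "N (\<lambda>i. value_at b (h i)) = sqrt (value_at b (weighted_R r s t))" for b
    by (simp add: N_def L2_set_def eq)
  \<comment> \<open>\<open>R\<close> is 1 at the three unit vectors, so the product takes the values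
    \<open>r^2\<close>, \<open>s^2\<close>, \<open>t^2\<close> there.\<close>
  have N: "N A = r" "N B = s" "N C = t"
    using assms(1-3) unfolding A_def B_def C_def norm by (simp_all add: weighted_R_def R_def)
  have zero: "A i + B i + C i = 0" if "i < n" for i
    unfolding A_def B_def C_def by (rule sos_weighted_R_imp_zero_sums[OF form eq that])
  have tri: "N f \<le> N g + N k" if "\<And>i. i < n \<Longrightarrow> f i + g i + k i = 0" for f g k
  proof -
    have "(f i)\<^sup>2 = (g i + k i)\<^sup>2" if "i < n" for i
      using \<open>\<And>i. i < n \<Longrightarrow> f i + g i + k i = 0\<close>[OF that] by algebra
    then have "N f = N (\<lambda>i. g i + k i)"
      by (simp add: N_def L2_set_def)
    then show ?thesis
      using L2_set_triangle_ineq[of g k] by (simp add: N_def)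
  qed
  have "N A \<le> N B + N C" "N B \<le> N A + N C" "N C \<le> N A + N B"
    using zero by (intro tri; force simp: algebra_simps)+
  then show ?thesis
    by (simp add: N)
qed

section \<open>Sufficiency\<close>

lemma Const_add: "Const (a + b) = Const a + Const b"
  by (simp add: Const_def single_add)

lemma Const_mult: "Const (a * b) = Const a * Const b"
  by (simp add: Const_def mult_single)

lemma Const_power: "Const (a ^ n) = Const a ^ n"
  by (induction n) (simp_all add: Const_mult, simp add: Const_def)

text \<open>The binary form in \<open>f\<close> and \<open>g\<close> is diagonalized by completing
  the square. Stating the conditions on \<open>e\<close> and \<open>k\<close> without roots or
  division allows use in the polynomial ring.\<close>

lemma weighted_Robinson_identity:
  fixes x y z :: "'a::comm_ring_1"
  assumes "e\<^sup>2 + k\<^sup>2 = s\<^sup>2" and "r\<^sup>2 + 2 * t * k = s\<^sup>2 + t\<^sup>2"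
  defines "f \<equiv> (z\<^sup>2 - x\<^sup>2) * (z\<^sup>2 + x\<^sup>2 - y\<^sup>2)" and "g \<equiv> (x\<^sup>2 - y\<^sup>2) * (x\<^sup>2 + y\<^sup>2 - z\<^sup>2)"
  shows "(r\<^sup>2 * x\<^sup>2 + s\<^sup>2 * y\<^sup>2 + t\<^sup>2 * z\<^sup>2) *
      (x^6 + y^6 + z^6 - x^4 * y\<^sup>2 - x\<^sup>2 * y^4 - x^4 * z\<^sup>2 - y^4 * z\<^sup>2
       - x\<^sup>2 * z^4 - y\<^sup>2 * z^4 + 3 * x\<^sup>2 * y\<^sup>2 * z\<^sup>2) =
    (t * f + k * g)\<^sup>2 + (e * g)\<^sup>2 + (r * (y * z * (y\<^sup>2 - z\<^sup>2)))\<^sup>2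
      + (s * (x * z * (z\<^sup>2 - x\<^sup>2)))\<^sup>2 + (t * (x * y * (x\<^sup>2 - y\<^sup>2)))\<^sup>2"
proof -
  have e: "e\<^sup>2 = s\<^sup>2 - k\<^sup>2" and r: "r\<^sup>2 = s\<^sup>2 + t\<^sup>2 - 2 * t * k"
    using assms(1,2) by (simp_all add: eq_diff_eq)
  show ?thesis
    unfolding power_mult_distrib[of e] power_mult_distrib[of r] e r f_def g_def
    by (simp add: eval_nat_numeral algebra_simps)
qed

text \<open>Law of cosines: in a triangle with sides \<open>r\<close>, \<open>s\<close>,
  \<open>t\<close>, \<open>k\<close> is \<open>s\<close> times the cosine of the angle opposite
  \<open>r\<close>, and \<open>e\<close> is \<open>s\<close> times its sine.\<close>

lemma triangle_imp_square_root_data: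
  fixes r s t :: real
  assumes "r \<ge> 0" "s \<ge> 0" "t \<ge> 0" "r \<le> s + t" "s \<le> r + t" "t \<le> r + s"
  obtains e k where "e\<^sup>2 + k\<^sup>2 = s\<^sup>2" and "r\<^sup>2 + 2 * t * k = s\<^sup>2 + t\<^sup>2"
proof -
  \<comment> \<open>For \<open>t = 0\<close> the triangle inequalities force \<open>r = s\<close>,
    so \<open>k = 0\<close> works.\<close>
  define k where "k = (if t = 0 then 0 else (s\<^sup>2 + t\<^sup>2 - r\<^sup>2) / (2 * t))"
  have k: "r\<^sup>2 + 2 * t * k = s\<^sup>2 + t\<^sup>2"
    using assms by (auto simp: k_def)
  have "k\<^sup>2 \<le> s\<^sup>2"
  proof (cases "t = 0")
    case True
    then show ?thesis
      by (simp add: k_def)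
  next
    case False
    have "r\<^sup>2 \<le> (s + t)\<^sup>2"
      using assms by (intro power_mono) auto
    moreover have "\<bar>s - t\<bar>\<^sup>2 \<le> r\<^sup>2"
      using assms by (intro power_mono) auto
    ultimately have "2 * t * - s \<le> 2 * t * k" "2 * t * k \<le> 2 * t * s"
      using k by (auto simp: power2_eq_square algebra_simps)
    then have "- s \<le> k" "k \<le> s"
      using False assms(3) by (simp_all only: mult_le_cancel_left)
    then show ?thesis
      by (simp add: abs_le_square_iff[symmetric])
  qed
  then have "(sqrt (s\<^sup>2 - k\<^sup>2))\<^sup>2 + k\<^sup>2 = s\<^sup>2"
    by simp
  with k show thesis
    using that by blast
qed

lemma triangle_imp_sos_weighted_R:
  assumes "r \<ge> 0" "s \<ge> 0" "t \<ge> 0" "r \<le> s + t" "s \<le> r + t" "t \<le> r + s"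
  shows "is_sos (weighted_R r s t)"
proof -
  obtain e k where ek: "e\<^sup>2 + k\<^sup>2 = s\<^sup>2" "r\<^sup>2 + 2 * t * k = s\<^sup>2 + t\<^sup>2"
    using triangle_imp_square_root_data[OF assms] .
  have two: "Const 2 = 2"
    by (simp add: Const_def)
  define f where "f = (Z\<^sup>2 - X\<^sup>2) * (Z\<^sup>2 + X\<^sup>2 - Y\<^sup>2)"
  define g where "g = (X\<^sup>2 - Y\<^sup>2) * (X\<^sup>2 + Y\<^sup>2 - Z\<^sup>2)"
  define hs where "hs = [Const t * f + Const k * g, Const e * g,
    Const r * (Y * Z * (Y\<^sup>2 - Z\<^sup>2)), Const s * (X * Z * (Z\<^sup>2 - X\<^sup>2)),
    Const t * (X * Y * (X\<^sup>2 - Y\<^sup>2))]"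
  have "weighted_R r s t = (\<Sum>p\<leftarrow>hs. p\<^sup>2)"
    \<comment> \<open>The \<open>Const\<close> laws, read backwards, reduce the conditions of the
      identity to the real equations \<open>ek\<close>.\<close>
    unfolding weighted_R_def R_def Const_power
    by (subst weighted_Robinson_identity[of "Const e" "Const k" "Const s" "Const r" "Const t"])
      (simp_all add: hs_def f_def g_def add.assoc
        flip: Const_power Const_add Const_mult two, simp_all add: ek)
  then have eq: "weighted_R r s t = (\<Sum>i<length hs. (hs ! i)\<^sup>2)"
    by (simp add: sum_list_sum_nth atLeast0LessThan)
  have "homog (2 + 2) f" "homog (2 + 2) g"
    unfolding f_def g_def
    by (intro homog_mult homog_add homog_diff homog_Var_power)+
  moreover have "homog (1 + 1 + 2) (Var u * Var v * ((Var u')\<^sup>2 - (Var v')\<^sup>2))" for u v u' v'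
    by (intro homog_mult homog_diff homog_Var_power homog_Var)
  ultimately have "\<forall>p\<in>set hs. homog 4 p"
    by (auto simp: hs_def numeral_eq_Suc intro!: homog_add homog_Const_mult)
  then have "\<forall>i<length hs. is_form (hs ! i)"
    by (auto simp: is_form_iff_homog)
  with eq homog_weighted_R show ?thesis
    unfolding is_sos_def is_form_iff_homog[of "weighted_R r s t"] by blast
qed

theorem theorem6p1:
  fixes r s t :: real
  assumes "r \<ge> 0" and "s \<ge> 0" and "t \<ge> 0"
  shows "is_sos ((Const (r^2) * X^2 + Const (s^2) * Y^2 + Const (t^2) * Z^2) * R)
           \<longleftrightarrow> r \<le> s + t \<and> s \<le> r + t \<and> t \<le> r + s"
  using sos_weighted_R_imp_triangle[OF assms] triangle_imp_sos_weighted_R[OF assms]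
  unfolding weighted_R_def by blast

end
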